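(* Let $\alpha\in(0,1]$ and let $w_{t,\alpha}$ be a real-valued function of $t\in[0,\infty)$ and $\alpha$. The ring $C^{\alpha}[0,\infty)$ (with pointwise addition and multiplication) together with the operator $D^{\alpha}:C^{\alpha}[0,\infty)\rightarrow C^{\alpha}[0,\infty)$ is a differential ring.
   Context: For a differentiable function $f:[0,\infty)\to\mathbb{R}$ and $\alpha\in(0,1]$, the generalized fractional derivative of order $\alpha$ at the point $t$ is $$D^{\alpha}f(t)=\lim_{\varepsilon\to 0}\frac{f(t+w_{t,\alpha}\,t^{1-\alpha}\varepsilon)-f(t)}{\varepsilon},$$ where $w_{t,\alpha}$ is a given function that may depend on $\alpha$ and $t$. A differentiable function $f:[0,\infty)\to\mathbb{R}$ is called $\alpha$-generalized fractional differentiable over $[0,\infty)$ if $D^{\alpha}f(t)$ exists for all $t\in[0,\infty)$. $C^{\alpha}[0,\infty)$ denotes the set of all real-valued $\alpha$-generalized fractional differentiable functions on $[0,\infty)$; it is a ring under pointwise addition and multiplication. A derivation on a commutative ring $R$ with unity is a map $d:R\to R$ satisfying $d(a+b)=d(a)+d(b)$ and $d(ab)=d(a)b+a\,d(b)$ for all $a,b\in R$; the pair $(R,d)$ is then called a differential ring.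
   Formalization: D^α need not map C^α[0,∞) to itself (α=1, w=1, f=(t−1)|t−1|). Proved: C^α is a commutative ring; D^α, with values among functions on [0,∞), is additive and Leibniz; it is a differential ring if D^α maps C^α into C^α. At t=0, α=1 the limit is one-sided. *)

theory Defs
  imports Complex_Main "HOL-Library.FuncSet" "HOL-Algebra.Ring"
begin

definition derivation :: "('a, 'b) ring_scheme \<Rightarrow> ('a \<Rightarrow> 'a) \<Rightarrow> bool" where
  "derivation R d \<longleftrightarrow>
     d \<in> carrier R \<rightarrow> carrier R \<and>
     (\<forall>a\<in>carrier R. \<forall>b\<in>carrier R.
        d (a \<oplus>\<^bsub>R\<^esub> b) = d a \<oplus>\<^bsub>R\<^esub> d b \<and>
        d (a \<otimes>\<^bsub>R\<^esub> b) = (d a \<otimes>\<^bsub>R\<^esub> b) \<oplus>\<^bsub>R\<^esub> (a \<otimes>\<^bsub>R\<^esub> d b))"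

definition differential_ring :: "('a, 'b) ring_scheme \<Rightarrow> ('a \<Rightarrow> 'a) \<Rightarrow> bool" where
  "differential_ring R d \<longleftrightarrow> cring R \<and> derivation R d"

text \<open>The factor \<open>t\<^sup>1\<^sup>-\<^sup>\<alpha>\<close>. For \<open>\<alpha> = 1\<close> it is the constant 1, also at \<open>t = 0\<close>,
  whereas \<open>0 powr 0 = 0\<close> in the library.\<close>

definition frac_weight :: "real \<Rightarrow> real \<Rightarrow> real" where
  "frac_weight \<alpha> t = (if \<alpha> = 1 then 1 else t powr (1 - \<alpha>))"

definition frac_quotient ::
    "(real \<Rightarrow> real \<Rightarrow> real) \<Rightarrow> real \<Rightarrow> (real \<Rightarrow> real) \<Rightarrow> real \<Rightarrow> real \<Rightarrow> real" where
  "frac_quotient w \<alpha> f t \<epsilon> = (f (t + w t \<alpha> * frac_weight \<alpha> t * \<epsilon>) - f t) / \<epsilon>"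

text \<open>The limit \<open>\<epsilon> \<rightarrow> 0\<close> runs over those \<open>\<epsilon>\<close> for which the shifted argument stays in the
  domain \<open>[0,\<infinity>)\<close>. This is the full two-sided limit except at \<open>t = 0\<close> with \<open>\<alpha> = 1\<close> and
  \<open>w 0 1 \<noteq> 0\<close>, where it is one-sided.\<close>

definition frac_filter :: "(real \<Rightarrow> real \<Rightarrow> real) \<Rightarrow> real \<Rightarrow> real \<Rightarrow> real filter" where
  "frac_filter w \<alpha> t = at 0 within {\<epsilon>. 0 \<le> t + w t \<alpha> * frac_weight \<alpha> t * \<epsilon>}"

definition frac_differentiable_at ::
    "(real \<Rightarrow> real \<Rightarrow> real) \<Rightarrow> real \<Rightarrow> (real \<Rightarrow> real) \<Rightarrow> real \<Rightarrow> bool" where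
  "frac_differentiable_at w \<alpha> f t \<longleftrightarrow>
     (\<exists>L. (frac_quotient w \<alpha> f t \<longlongrightarrow> L) (frac_filter w \<alpha> t))"

text \<open>Functions \<open>[0,\<infinity>) \<rightarrow> \<real>\<close> are represented by elements of \<open>extensional {0..}\<close>, so that
  equality of representatives is equality on \<open>[0,\<infinity>)\<close>.\<close>

definition frac_deriv ::
    "(real \<Rightarrow> real \<Rightarrow> real) \<Rightarrow> real \<Rightarrow> (real \<Rightarrow> real) \<Rightarrow> (real \<Rightarrow> real)" where
  "frac_deriv w \<alpha> f = (\<lambda>t\<in>{0..}. Lim (frac_filter w \<alpha> t) (frac_quotient w \<alpha> f t))"

definition frac_space :: "(real \<Rightarrow> real \<Rightarrow> real) \<Rightarrow> real \<Rightarrow> (real \<Rightarrow> real) set" where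
  "frac_space w \<alpha> = {f \<in> extensional {0..}. (\<forall>t\<ge>0. f differentiable (at t within {0..})) \<and>
     (\<forall>t\<ge>0. frac_differentiable_at w \<alpha> f t)}"

text \<open>The operations are the pointwise ones of all functions on \<open>[0,\<infinity>)\<close>; they are
  meaningful also for arguments outside the carrier. This matters because \<open>frac_deriv w \<alpha>\<close>
  need not map the carrier to itself: for \<open>w = 1\<close>, \<open>\<alpha> = 1\<close> it sends
  \<open>(t - 1) * \<bar>t - 1\<bar>\<close> to \<open>2 * \<bar>t - 1\<bar>\<close>.\<close>

definition frac_ring :: "(real \<Rightarrow> real \<Rightarrow> real) \<Rightarrow> real \<Rightarrow> (real \<Rightarrow> real) ring" where
  "frac_ring w \<alpha> =
     \<lparr>carrier = frac_space w \<alpha>,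
      mult = (\<lambda>f g. \<lambda>t\<in>{0..}. f t * g t),
      one = (\<lambda>t\<in>{0..}. 1),
      zero = (\<lambda>t\<in>{0..}. 0),
      add = (\<lambda>f g. \<lambda>t\<in>{0..}. f t + g t)\<rparr>"

end

theory Submission
  imports Defs
begin

text \<open>
  Write \<open>c = w t \<alpha> * frac_weight \<alpha> t\<close>. The fractional difference quotient of \<open>f\<close> at \<open>t\<close> is the
  ordinary difference quotient at \<open>\<epsilon> = 0\<close> of the composite \<open>\<epsilon> \<mapsto> f (t + c * \<epsilon>)\<close>, so the chain
  rule gives it the limit \<open>f' t * c\<close> (\<open>frac_quotient_tendsto\<close>). Hence every differentiable function
  on \<open>[0,\<infinity>)\<close> is fractionally differentiable, and the fractional derivative is the ordinary
  derivative multiplied by a fixed function of \<open>t\<close> (\<open>frac_deriv_eq\<close>); reading off the value of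
  the limit requires that the admissible increments accumulate at 0 (\<open>frac_filter_nontrivial\<close>).

  The carrier therefore consists of all differentiable functions on \<open>[0,\<infinity>)\<close>, which form a
  commutative ring by the usual differentiation rules. Multiplying a derivation by a fixed
  function preserves additivity and the Leibniz rule, so both pass from the ordinary derivative
  to the fractional one.
\<close>

text \<open>Whatever the sign of \<open>w t \<alpha> * frac_weight \<alpha> t\<close>, the admissible increments contain a whole
  half-line starting at 0; without this the \<open>Lim\<close> in the fractional derivative would be
  unspecified.\<close>

lemma frac_filter_nontrivial:
  assumes "0 \<le> t"
  shows "frac_filter w \<alpha> t \<noteq> bot"
proof -
  define c where "c = w t \<alpha> * frac_weight \<alpha> t"
  define S where "S = {\<epsilon>. 0 \<le> t + c * \<epsilon>}"
  have "at 0 within S \<noteq> bot"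
  proof (cases "0 \<le> c")
    case True
    then have "{0<..} \<subseteq> S"
      using assms by (auto simp: S_def)
    then have "at_right 0 \<le> at 0 within S"
      by (rule at_le)
    then show ?thesis
      using trivial_limit_at_right_real[of "0::real"] by (auto simp: bot_unique)
  next
    case False
    then have "{..<0} \<subseteq> S"
      using assms by (auto simp: S_def mult_nonpos_nonpos)
    then have "at_left 0 \<le> at 0 within S"
      by (rule at_le)
    then show ?thesis
      using trivial_limit_at_left_real[of "0::real"] by (auto simp: bot_unique)
  qed
  then show ?thesis
    by (simp add: frac_filter_def S_def c_def)
qed

text \<open>This is the chain rule for \<open>f\<close> after the affine map \<open>\<epsilon> \<mapsto> t + c * \<epsilon>\<close>. The restriction on
  \<open>\<epsilon>\<close> built into the filter is exactly what keeps the affine map inside the domain, so that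
  the one-sided derivative at \<open>t = 0\<close> suffices.\<close>

lemma frac_quotient_tendsto:
  assumes "(f has_real_derivative D) (at t within {0..})"
  shows "(frac_quotient w \<alpha> f t \<longlongrightarrow> D * (w t \<alpha> * frac_weight \<alpha> t)) (frac_filter w \<alpha> t)"
proof -
  define c where "c = w t \<alpha> * frac_weight \<alpha> t"
  define S where "S = {\<epsilon>. 0 \<le> t + c * \<epsilon>}"
  define h where "h \<epsilon> = t + c * \<epsilon>" for \<epsilon>
  have "(f has_real_derivative D) (at (h 0) within h ` S)"
    by (rule DERIV_subset[where s = "{0..}"]) (use assms in \<open>auto simp: h_def S_def\<close>)
  moreover have "(h has_real_derivative c) (at 0 within S)"
    unfolding h_def by (auto intro!: derivative_eq_intros)
  ultimately have "(f \<circ> h has_real_derivative D * c) (at 0 within S)"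
    by (rule DERIV_image_chain)
  then have "((\<lambda>\<epsilon>. (f (h \<epsilon>) - f t) / \<epsilon>) \<longlongrightarrow> D * c) (at 0 within S)"
    by (simp add: has_field_derivative_iff h_def)
  then show ?thesis
    by (simp add: frac_filter_def frac_quotient_def[abs_def] S_def c_def h_def)
qed

lemma frac_deriv_eq:
  assumes "0 \<le> t" and "(f has_real_derivative D) (at t within {0..})"
  shows "frac_deriv w \<alpha> f t = D * (w t \<alpha> * frac_weight \<alpha> t)"
  using tendsto_Lim[OF frac_filter_nontrivial[OF assms(1)] frac_quotient_tendsto[OF assms(2)]]
    assms(1) by (simp add: frac_deriv_def)

lemma frac_space_eq_differentiable:
  "frac_space w \<alpha> =
     {f \<in> extensional {0..}. \<forall>t\<ge>0. f differentiable (at t within {0..})}"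
  unfolding frac_space_def frac_differentiable_at_def real_differentiable_def
  using frac_quotient_tendsto by blast

lemma frac_space_has_derivative:
  assumes "f \<in> frac_space w \<alpha>" and "0 \<le> t"
  obtains D where "(f has_real_derivative D) (at t within {0..})"
  using assms by (auto simp: frac_space_eq_differentiable real_differentiable_def)

lemma has_real_derivative_restrict:
  assumes "(f has_real_derivative D) (at t within S)" and "t \<in> S"
  shows "(restrict f S has_real_derivative D) (at t within S)"
  using has_field_derivative_transform_within[OF assms(1) zero_less_one assms(2)] by simp

lemma restrict_in_frac_space:
  assumes "\<And>t. 0 \<le> t \<Longrightarrow> f differentiable (at t within {0..})"
  shows "restrict f {0..} \<in> frac_space w \<alpha>"
  using assms unfolding frac_space_eq_differentiable real_differentiable_def
  by (auto intro: has_real_derivative_restrict)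

lemma cring_frac_ring: "cring (frac_ring w \<alpha>)"
proof -
  let ?R = "frac_ring w \<alpha>"
  have diff: "f differentiable (at t within {0..})"
    if "f \<in> frac_space w \<alpha>" and "0 \<le> t" for f t
    using that by (simp add: frac_space_eq_differentiable)
  have ext: "(\<lambda>t\<in>{0..}. f t) = f" if "f \<in> frac_space w \<alpha>" for f
    using that by (simp add: frac_space_def extensional_restrict)
  have closed:
    "(\<lambda>t\<in>{0..}. f t + g t) \<in> frac_space w \<alpha>"
    "(\<lambda>t\<in>{0..}. f t * g t) \<in> frac_space w \<alpha>"
    "(\<lambda>t\<in>{0..}. - f t) \<in> frac_space w \<alpha>"
    if "f \<in> frac_space w \<alpha>" and "g \<in> frac_space w \<alpha>" for f g
    by (intro restrict_in_frac_space differentiable_add differentiable_mult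
        differentiable_minus; use that in \<open>simp add: diff\<close>)+
  have const_mem: "(\<lambda>t\<in>{0..}. k) \<in> frac_space w \<alpha>" for k
    by (intro restrict_in_frac_space differentiable_const)
  have inverse: "\<exists>g\<in>carrier ?R. g \<oplus>\<^bsub>?R\<^esub> f = \<zero>\<^bsub>?R\<^esub>" if "f \<in> carrier ?R" for f
  proof
    show "(\<lambda>t\<in>{0..}. - f t) \<in> carrier ?R"
      using that closed(3) by (simp add: frac_ring_def)
  qed (auto simp: frac_ring_def)
  show ?thesis
  proof (rule cringI)
    show "abelian_group ?R"
      by (rule abelian_groupI)
        (use inverse in \<open>simp_all add: frac_ring_def closed const_mem ext algebra_simps
          cong: restrict_cong\<close>)
    show "comm_monoid ?R"
      by (rule comm_monoidI)
        (simp_all add: frac_ring_def closed const_mem ext algebra_simps cong: restrict_cong)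
  qed (simp_all add: frac_ring_def algebra_simps cong: restrict_cong)
qed

lemma frac_deriv_add:
  assumes "f \<in> frac_space w \<alpha>" and "g \<in> frac_space w \<alpha>"
  shows "frac_deriv w \<alpha> (\<lambda>t\<in>{0..}. f t + g t) =
    (\<lambda>t\<in>{0..}. frac_deriv w \<alpha> f t + frac_deriv w \<alpha> g t)"
proof (rule extensionalityI)
  fix t :: real
  assume "t \<in> {0..}"
  then have t: "0 \<le> t" by simp
  obtain D where D: "(f has_real_derivative D) (at t within {0..})"
    using frac_space_has_derivative[OF assms(1) t] .
  obtain E where E: "(g has_real_derivative E) (at t within {0..})"
    using frac_space_has_derivative[OF assms(2) t] .
  have "((\<lambda>t\<in>{0..}. f t + g t) has_real_derivative D + E) (at t within {0..})"
    using t by (intro has_real_derivative_restrict DERIV_add D E) simp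
  from frac_deriv_eq[OF t this] frac_deriv_eq[OF t D] frac_deriv_eq[OF t E] t
  show "frac_deriv w \<alpha> (\<lambda>t\<in>{0..}. f t + g t) t =
    (\<lambda>t\<in>{0..}. frac_deriv w \<alpha> f t + frac_deriv w \<alpha> g t) t"
    by (simp add: algebra_simps)
qed (auto simp: frac_deriv_def)

lemma frac_deriv_mult:
  assumes "f \<in> frac_space w \<alpha>" and "g \<in> frac_space w \<alpha>"
  shows "frac_deriv w \<alpha> (\<lambda>t\<in>{0..}. f t * g t) =
    (\<lambda>t\<in>{0..}. frac_deriv w \<alpha> f t * g t + f t * frac_deriv w \<alpha> g t)"
proof (rule extensionalityI)
  fix t :: real
  assume "t \<in> {0..}"
  then have t: "0 \<le> t" by simp
  obtain D where D: "(f has_real_derivative D) (at t within {0..})"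
    using frac_space_has_derivative[OF assms(1) t] .
  obtain E where E: "(g has_real_derivative E) (at t within {0..})"
    using frac_space_has_derivative[OF assms(2) t] .
  have "((\<lambda>t\<in>{0..}. f t * g t) has_real_derivative D * g t + E * f t) (at t within {0..})"
    using t by (intro has_real_derivative_restrict DERIV_mult D E) simp
  from frac_deriv_eq[OF t this] frac_deriv_eq[OF t D] frac_deriv_eq[OF t E] t
  show "frac_deriv w \<alpha> (\<lambda>t\<in>{0..}. f t * g t) t =
    (\<lambda>t\<in>{0..}. frac_deriv w \<alpha> f t * g t + f t * frac_deriv w \<alpha> g t) t"
    by (simp add: algebra_simps)
qed (auto simp: frac_deriv_def)

theorem theorem6:
  fixes w :: "real \<Rightarrow> real \<Rightarrow> real" and \<alpha> :: real
  assumes "0 < \<alpha>" and "\<alpha> \<le> 1"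
  shows "cring (frac_ring w \<alpha>) \<and>
    (\<forall>f\<in>carrier (frac_ring w \<alpha>). \<forall>g\<in>carrier (frac_ring w \<alpha>).
       frac_deriv w \<alpha> (f \<oplus>\<^bsub>frac_ring w \<alpha>\<^esub> g)
         = frac_deriv w \<alpha> f \<oplus>\<^bsub>frac_ring w \<alpha>\<^esub> frac_deriv w \<alpha> g \<and>
       frac_deriv w \<alpha> (f \<otimes>\<^bsub>frac_ring w \<alpha>\<^esub> g)
         = (frac_deriv w \<alpha> f \<otimes>\<^bsub>frac_ring w \<alpha>\<^esub> g)
             \<oplus>\<^bsub>frac_ring w \<alpha>\<^esub> (f \<otimes>\<^bsub>frac_ring w \<alpha>\<^esub> frac_deriv w \<alpha> g)) \<and>
    (frac_deriv w \<alpha> \<in> carrier (frac_ring w \<alpha>) \<rightarrow> carrier (frac_ring w \<alpha>)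
       \<longrightarrow> differential_ring (frac_ring w \<alpha>) (frac_deriv w \<alpha>))"
proof -
  let ?R = "frac_ring w \<alpha>" and ?D = "frac_deriv w \<alpha>"
  have rules: "?D (f \<oplus>\<^bsub>?R\<^esub> g) = ?D f \<oplus>\<^bsub>?R\<^esub> ?D g \<and>
      ?D (f \<otimes>\<^bsub>?R\<^esub> g) = (?D f \<otimes>\<^bsub>?R\<^esub> g) \<oplus>\<^bsub>?R\<^esub> (f \<otimes>\<^bsub>?R\<^esub> ?D g)"
    if "f \<in> carrier ?R" and "g \<in> carrier ?R" for f g
    using that by (simp add: frac_ring_def frac_deriv_add frac_deriv_mult cong: restrict_cong)
  then show ?thesis
    by (simp add: cring_frac_ring differential_ring_def derivation_def)
qed

end
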